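(* Consider the general heterogeneous Deffuant-Weisbuch (DW) model described in the context. For any initial state $X(0)\in\mathbb{R}^{n\times d}$, the opinion of each agent converges to a fixed random vector with probability one, i.e., there exist random vectors $\mathbf{x}_i^*\in\mathbb{R}^d$, $i\in\mathcal{N}$, such that $$\mathbb{P}\left(\lim_{t\to\infty}\mathbf{x}_i(t)=\mathbf{x}_i^*\right)=1,\qquad \forall i\in\mathcal{N}.$$ Moreover, with probability one, for all $i\neq j$ in $\mathcal{N}$, either $\mathbf{x}_i^*=\mathbf{x}_j^*$ or $\|\mathbf{x}_i^*-\mathbf{x}_j^*\|\geq \max\{r_i,r_j\}$.
   Context: Setting (general heterogeneous DW model). Let $n\geq 3$, $d\geq 1$ be integers and $\mathcal{N}=\{1,\dots,n\}$ the set of agents. Each agent $i\in\mathcal{N}$ has a confidence bound $r_i>0$ and a weighting factor $\mu_i\in(0,1)$ (arbitrary, possibly different across agents). At each time $t\in\{0,1,2,\dots\}$ agent $i$ has an opinion $\mathbf{x}_i(t)\in\mathbb{R}^d$, and $X(t)=(\mathbf{x}_1(t),\dots,\mathbf{x}_n(t))^\top\in\mathbb{R}^{n\times d}$; the initial state $X(0)$ is deterministic. $\|\cdot\|$ is the Euclidean norm and $\mathbb{1}_{\{\cdot\}}$ is the indicator (equal to $1$ if the property holds and $0$ otherwise). Let $\mathcal{A}=\{\{i,j\}: i,j\in\mathcal{N},\ i<j\}$. At each time $t\ge 0$ a pair $\{i_t,j_t\}$ is selected uniformly at random from $\mathcal{A}$, independently over time; $\mathbb{P}$ is the corresponding product probability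 measure on $\Omega=\mathcal{A}^\infty$. The opinions are updated by $$\mathbf{x}_{i_t}(t+1)=\mathbf{x}_{i_t}(t)+\mu_{i_t}\mathbb{1}_{\{\|\mathbf{x}_{j_t}(t)-\mathbf{x}_{i_t}(t)\|\le r_{i_t}\}}(\mathbf{x}_{j_t}(t)-\mathbf{x}_{i_t}(t)),$$ $$\mathbf{x}_{j_t}(t+1)=\mathbf{x}_{j_t}(t)+\mu_{j_t}\mathbb{1}_{\{\|\mathbf{x}_{j_t}(t)-\mathbf{x}_{i_t}(t)\|\le r_{j_t}\}}(\mathbf{x}_{i_t}(t)-\mathbf{x}_{j_t}(t)),$$ and $\mathbf{x}_k(t+1)=\mathbf{x}_k(t)$ for $k\in\mathcal{N}\setminus\{i_t,j_t\}$. *)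

theory Defs
  imports "HOL-Probability.Probability"
begin

definition agents :: "nat \<Rightarrow> nat set" where
  "agents n = {1..n}"

definition agent_pairs :: "nat \<Rightarrow> nat set set" where
  "agent_pairs n = {{i, j} | i j. i \<in> agents n \<and> j \<in> agents n \<and> i < j}"

(* The sample space is exactly the set of all sequences of elements of agent_pairs n. *)
definition DW_measure :: "nat \<Rightarrow> (nat \<Rightarrow> nat set) measure" where
  "DW_measure n = PiM UNIV (\<lambda>t::nat. uniform_count_measure (agent_pairs n))"

(* A selected pair is an unordered set e, so the two update equations, which are symmetric in
   the two agents, become one equation for k \<in> e; the_elem (e - {k}) is the other agent of e.
   The lemmas DW_step_selected and DW_step_other give the equations in their usual form. *)
definition DW_step ::
  "(nat \<Rightarrow> real) \<Rightarrow> (nat \<Rightarrow> real) \<Rightarrow> nat set \<Rightarrow> (nat \<Rightarrow> real ^ 'd) \<Rightarrow> nat \<Rightarrow> real ^ 'd" where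
  "DW_step r \<mu> e x k =
     (if k \<in> e
      then let l = the_elem (e - {k})
           in x k + (\<mu> k * of_bool (norm (x l - x k) \<le> r k)) *\<^sub>R (x l - x k)
      else x k)"

(* Opinions of indices outside agents n never influence those of the agents, because every
   selected pair is a subset of agents n. *)
primrec DW_opinion ::
  "(nat \<Rightarrow> real) \<Rightarrow> (nat \<Rightarrow> real) \<Rightarrow> (nat \<Rightarrow> real ^ 'd) \<Rightarrow> (nat \<Rightarrow> nat set) \<Rightarrow> nat \<Rightarrow> nat \<Rightarrow> real ^ 'd"
where
  "DW_opinion r \<mu> x0 \<omega> 0 = x0"
| "DW_opinion r \<mu> x0 \<omega> (Suc t) = DW_step r \<mu> (\<omega> t) (DW_opinion r \<mu> x0 \<omega> t)"

lemma DW_step_selected: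
  assumes "i \<noteq> j"
  shows "DW_step r \<mu> {i, j} x i =
           x i + (\<mu> i * of_bool (norm (x j - x i) \<le> r i)) *\<^sub>R (x j - x i)"
    and "DW_step r \<mu> {i, j} x j =
           x j + (\<mu> j * of_bool (norm (x j - x i) \<le> r j)) *\<^sub>R (x i - x j)"
proof -
  have "{i, j} - {i} = {j}" "{i, j} - {j} = {i}"
    using assms by auto
  then show "DW_step r \<mu> {i, j} x i =
           x i + (\<mu> i * of_bool (norm (x j - x i) \<le> r i)) *\<^sub>R (x j - x i)"
    and "DW_step r \<mu> {i, j} x j =
           x j + (\<mu> j * of_bool (norm (x j - x i) \<le> r j)) *\<^sub>R (x i - x j)"
    by (simp_all add: DW_step_def Let_def norm_minus_commute)
qed

lemma DW_step_other: "k \<notin> {i, j} \<Longrightarrow> DW_step r \<mu> {i, j} x k = x k"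
  by (simp add: DW_step_def)

lemma finite_agent_pairs: "finite (agent_pairs n)"
proof (rule finite_subset)
  show "agent_pairs n \<subseteq> Pow (agents n)"
    by (auto simp: agent_pairs_def)
qed (simp add: agents_def)

lemma agent_pairs_nonempty:
  assumes "n \<ge> 2"
  shows "agent_pairs n \<noteq> {}"
proof -
  have "{1, 2} \<in> agent_pairs n"
    unfolding agent_pairs_def agents_def using assms by force
  then show ?thesis by blast
qed

lemma space_DW_measure: "space (DW_measure n) = UNIV \<rightarrow>\<^sub>E agent_pairs n"
  by (simp add: DW_measure_def space_PiM space_uniform_count_measure)

lemma prob_space_DW_measure:
  assumes "n \<ge> 2"
  shows "prob_space (DW_measure n)"
  unfolding DW_measure_def
  by (intro prob_space_PiM prob_space_uniform_count_measure finite_agent_pairs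
      agent_pairs_nonempty assms)

end

theory Submission
  imports Defs
begin

text \<open>
  The only obstacle to convergence is that agents keep being attracted over large distances.  Colour
  the agents, and call a colouring stable at a state if agents of one colour are within \<open>\<delta>\<close> of each
  other and no agent has an agent of another colour in its range.  While a colouring stays stable,
  agents move only inside the convex hull of their own colour class, so these hulls are nested and
  have diameter at most \<open>\<delta>\<close> (\<open>stable_confines\<close>).  If for each of a sequence of \<open>\<delta>\<close> tending to 0 some
  colouring is eventually always stable, then each trajectory is Cauchy, and two limits either
  coincide or are separated by both confidence bounds.

  It remains to see that, for each small \<open>\<delta>\<close>, some colouring is almost surely eventually stable.
  Rank a state by the least number of colours for which every class has diameter at most \<open>\<delta>\<close>.  The
  deterministic half of the proof (\<open>merge_blocks\<close>) is that whenever an agent \<open>i\<close> has an agent of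
  another class in range, some sequence of selections of bounded length merges the two classes into
  one of diameter at most \<open>\<delta>\<close>.  This works for arbitrary weights and confidence bounds because \<open>i\<close>
  acts as a carrier: it can approach any agent \<open>k\<close> in its range until it enters the range of \<open>k\<close>, and
  from then on \<open>k\<close> is drawn to \<open>i\<close> as well.  After \<open>i\<close> has done this with each agent of the two
  classes, all positions are convex combinations that give a fixed weight \<open>\<gamma>\<close> to one common point,
  so the diameter has shrunk by the factor \<open>1 - \<gamma>\<close>; repeat.

  The probabilistic half compares worst cases.  Fix \<open>\<delta>\<close>, say that a trajectory settles if some
  colouring is eventually always stable, and let \<open>s\<close> be the supremum over all initial states of the
  probability of not settling.  From a state of rank \<open>k\<close>, either no agent ever gets
  another class into its range, and the trajectory settles, or this happens at some random time, and
  then a prescribed sequence of selections lowers the rank with probability bounded below.  By induction on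
  \<open>k\<close> the probability of not settling is at most \<open>(1 - P ^ k) * s\<close> for a constant \<open>P > 0\<close>
  (\<open>unsettled_prob_rank\<close>).  Since all states have rank at most \<open>n\<close>, this gives
  \<open>s \<le> (1 - P ^ n) * s\<close>, hence \<open>s = 0\<close>.
\<close>

section \<open>Convex combinations with a prescribed weight on a point\<close>

text \<open>
  Weights on \<open>p\<close> are tracked by membership in the copy of \<open>H\<close> shrunk towards \<open>p\<close> by the factor
  \<open>1 - a\<close>.
\<close>

definition toward :: "'a::real_vector \<Rightarrow> real \<Rightarrow> 'a set \<Rightarrow> 'a set" where
  "toward p a H = (\<lambda>z. a *\<^sub>R p + (1 - a) *\<^sub>R z) ` H"

lemma toward_0 [simp]: "toward p 0 H = H"
  by (simp add: toward_def)

lemma self_in_toward_1: "H \<noteq> {} \<Longrightarrow> p \<in> toward p 1 H"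
  by (auto simp: toward_def)

lemma convex_cone_combination:
  assumes "convex H" "u \<in> H" "v \<in> H" "0 \<le> s" "0 \<le> t"
  obtains z where "z \<in> H" "s *\<^sub>R u + t *\<^sub>R v = (s + t) *\<^sub>R z"
proof (cases "s + t = 0")
  case True
  then have "s = 0" "t = 0" using assms by auto
  with that[of u] assms show ?thesis by simp
next
  case False
  define z where "z = (s / (s + t)) *\<^sub>R u + (t / (s + t)) *\<^sub>R v"
  have "z \<in> H"
    unfolding z_def using assms False
    by (intro convexD) (auto simp: add_divide_distrib[symmetric])
  moreover have "s *\<^sub>R u + t *\<^sub>R v = (s + t) *\<^sub>R z"
    using False by (simp add: z_def scaleR_add_right)
  ultimately show ?thesis using that by blast
qed

text \<open>
  The weights on \<open>p\<close> combine in the same way as the points, and what is left over is a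
  combination of points of \<open>H\<close>.
\<close>

lemma toward_mix:
  assumes "convex H" "x \<in> toward p a H" "y \<in> toward p b H"
    and "0 \<le> w" "w \<le> 1" "a \<le> 1" "b \<le> 1"
  shows "(1 - w) *\<^sub>R x + w *\<^sub>R y \<in> toward p ((1 - w) * a + w * b) H"
proof -
  obtain u v where u: "u \<in> H" "x = a *\<^sub>R p + (1 - a) *\<^sub>R u"
    and v: "v \<in> H" "y = b *\<^sub>R p + (1 - b) *\<^sub>R v"
    using assms by (auto simp: toward_def)
  obtain z where z: "z \<in> H" "((1 - w) * (1 - a)) *\<^sub>R u + (w * (1 - b)) *\<^sub>R v
      = ((1 - w) * (1 - a) + w * (1 - b)) *\<^sub>R z"
    using convex_cone_combination[OF assms(1) u(1) v(1), of "(1 - w) * (1 - a)" "w * (1 - b)"]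
      assms by auto
  have "(1 - w) *\<^sub>R x + w *\<^sub>R y = ((1 - w) * a + w * b) *\<^sub>R p +
      (((1 - w) * (1 - a)) *\<^sub>R u + (w * (1 - b)) *\<^sub>R v)"
    by (simp add: u v algebra_simps)
  also have "\<dots> = ((1 - w) * a + w * b) *\<^sub>R p + (1 - ((1 - w) * a + w * b)) *\<^sub>R z"
    unfolding z by (simp add: algebra_simps)
  finally show ?thesis using z(1) by (auto simp: toward_def)
qed

lemma toward_antimono:
  assumes "convex H" "p \<in> H" "a \<le> b" "b \<le> 1"
  shows "toward p b H \<subseteq> toward p a H"
proof
  fix x assume "x \<in> toward p b H"
  then obtain u where u: "u \<in> H" "x = b *\<^sub>R p + (1 - b) *\<^sub>R u" by (auto simp: toward_def)
  obtain z where z: "z \<in> H" "(b - a) *\<^sub>R p + (1 - b) *\<^sub>R u = ((b - a) + (1 - b)) *\<^sub>R z"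
    using convex_cone_combination[OF assms(1,2) u(1), of "b - a" "1 - b"] assms by auto
  have "x = a *\<^sub>R p + ((b - a) *\<^sub>R p + (1 - b) *\<^sub>R u)"
    by (simp add: u algebra_simps)
  also have "\<dots> = a *\<^sub>R p + (1 - a) *\<^sub>R z"
    unfolding z by simp
  finally show "x \<in> toward p a H" using z(1) by (auto simp: toward_def)
qed

text \<open>
  The common part \<open>a *\<^sub>R p\<close> cancels in a difference.  This is how a shared weight becomes a
  contraction of the diameter.
\<close>

lemma dist_toward_toward:
  fixes p :: "'a::real_normed_vector"
  assumes "u \<in> toward p a H" "v \<in> toward p a H" "a \<le> 1"
    and "\<And>y z. y \<in> H \<Longrightarrow> z \<in> H \<Longrightarrow> norm (y - z) \<le> B"
  shows "norm (u - v) \<le> (1 - a) * B"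
proof -
  obtain y z where "y \<in> H" "z \<in> H" "u - v = (1 - a) *\<^sub>R (y - z)"
    using assms(1,2) by (auto simp: toward_def algebra_simps)
  with assms(3,4) show ?thesis by (simp add: mult_left_mono)
qed

text \<open>
  If \<open>p\<close> is central, in the sense that \<open>A < B\<close>, then a point with some weight on \<open>p\<close> is nearer to all
  of \<open>H\<close> than the diameter bound \<open>B\<close>.  This keeps the gathering agent in range even when the diameter
  slightly exceeds its confidence bound.
\<close>

lemma dist_toward:
  fixes p :: "'a::real_normed_vector"
  assumes "u \<in> toward p a H" "v \<in> H" "0 \<le> a" "a \<le> 1"
    and "\<And>y. y \<in> H \<Longrightarrow> norm (p - y) \<le> A"
    and "\<And>y z. y \<in> H \<Longrightarrow> z \<in> H \<Longrightarrow> norm (y - z) \<le> B"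
  shows "norm (u - v) \<le> a * A + (1 - a) * B"
proof -
  obtain z where z: "z \<in> H" "u = a *\<^sub>R p + (1 - a) *\<^sub>R z"
    using assms(1) by (auto simp: toward_def)
  have "u - v = a *\<^sub>R (p - v) + (1 - a) *\<^sub>R (z - v)"
    by (simp add: z algebra_simps)
  also have "norm \<dots> \<le> a * norm (p - v) + (1 - a) * norm (z - v)"
    using norm_triangle_ineq[of "a *\<^sub>R (p - v)" "(1 - a) *\<^sub>R (z - v)"] assms(3,4) by simp
  also have "\<dots> \<le> a * A + (1 - a) * B"
    using assms z by (intro add_mono mult_left_mono) auto
  finally show ?thesis .
qed

text \<open>Balls are convex, so a bound on distances passes to the hull in one argument at a time.\<close>

lemma norm_convex_hull_le:
  fixes P :: "'a::real_normed_vector set"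
  assumes "\<And>u v. u \<in> P \<Longrightarrow> v \<in> P \<Longrightarrow> norm (u - v) \<le> B"
    and "u \<in> convex hull P" "v \<in> convex hull P"
  shows "norm (u - v) \<le> B"
proof -
  have "convex hull P \<subseteq> cball y B" if "y \<in> P" for y
    using assms(1)[OF that] by (intro hull_minimal) (auto simp: dist_norm)
  then have "P \<subseteq> cball u B"
    using assms(2) by (force simp: dist_norm norm_minus_commute)
  then have "convex hull P \<subseteq> cball u B"
    by (intro hull_minimal) auto
  then show ?thesis using assms(3) by (auto simp: dist_norm)
qed

section \<open>The update rule\<close>

lemma agent_pairsI: "i \<in> agents n \<Longrightarrow> j \<in> agents n \<Longrightarrow> i \<noteq> j \<Longrightarrow> {i, j} \<in> agent_pairs n"
  unfolding agent_pairs_def by (cases "i < j") (auto, metis insert_commute nat_neq_iff)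

lemma agent_pairsE:
  assumes "e \<in> agent_pairs n" "k \<in> e"
  obtains l where "k \<in> agents n" "l \<in> agents n" "k \<noteq> l" "e = {k, l}"
  using assms unfolding agent_pairs_def by fastforce

text \<open>
  There are finitely many agents, so the weights and their complements share a positive lower bound
  \<open>\<kappa>\<close>, and the confidence bounds lie between positive constants \<open>\<rho>\<close> and \<open>R\<close>.
\<close>

locale DW_model =
  fixes n :: nat and r \<mu> :: "nat \<Rightarrow> real" and \<kappa> \<rho> R :: real
  assumes n_ge_2: "n \<ge> 2"
    and \<kappa>_pos: "0 < \<kappa>" and \<rho>_pos: "0 < \<rho>"
    and \<kappa>_le: "i \<in> agents n \<Longrightarrow> \<kappa> \<le> \<mu> i" and \<mu>_le: "i \<in> agents n \<Longrightarrow> \<mu> i \<le> 1 - \<kappa>"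
    and \<rho>_le: "i \<in> agents n \<Longrightarrow> \<rho> \<le> r i" and r_le: "i \<in> agents n \<Longrightarrow> r i \<le> R"
begin

abbreviation step :: "nat set \<Rightarrow> (nat \<Rightarrow> real ^ 'd) \<Rightarrow> nat \<Rightarrow> real ^ 'd" where
  "step \<equiv> DW_step r \<mu>"

abbreviation run :: "nat set list \<Rightarrow> (nat \<Rightarrow> real ^ 'd) \<Rightarrow> nat \<Rightarrow> real ^ 'd" where
  "run \<equiv> fold step"

lemma one_in_agents: "1 \<in> agents n"
  using n_ge_2 by (simp add: agents_def)

lemma \<kappa>_less_1: "\<kappa> < 1"
  using \<kappa>_le[OF one_in_agents] \<mu>_le[OF one_in_agents] \<kappa>_pos by linarith

lemma \<rho>_le_R: "\<rho> \<le> R"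
  using \<rho>_le[OF one_in_agents] r_le[OF one_in_agents] by linarith

lemma step_in_range:
  assumes "k \<noteq> l" "norm (x l - x k) \<le> r k"
  shows "step {k, l} x k = (1 - \<mu> k) *\<^sub>R x k + \<mu> k *\<^sub>R x l"
  using DW_step_selected(1)[OF assms(1), of r \<mu> x] assms(2) by (simp add: algebra_simps)

lemma step_out_of_range:
  assumes "k \<noteq> l" "\<not> norm (x l - x k) \<le> r k"
  shows "step {k, l} x k = x k"
  using DW_step_selected(1)[OF assms(1), of r \<mu> x] assms(2) by simp

text \<open>
  A selected agent moves within the segment to its partner, and only if the partner is in its range.
  So if the agent of \<open>S\<close> that moves finds only partners in \<open>S\<close>, it stays in any convex set that
  contains the positions of \<open>S\<close>.
\<close>

lemma step_in_convex:
  assumes "convex H" "e \<in> agent_pairs n" "k \<in> S" "\<And>l. l \<in> S \<Longrightarrow> x l \<in> H"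
    and closed: "\<And>l. l \<in> e \<Longrightarrow> k \<in> e \<Longrightarrow> l \<noteq> k \<Longrightarrow> norm (x l - x k) \<le> r k \<Longrightarrow> l \<in> S"
  shows "step e x k \<in> H"
proof (cases "k \<in> e")
  case True
  then obtain l where l: "k \<in> agents n" "l \<in> agents n" "k \<noteq> l" "e = {k, l}"
    using assms(2) agent_pairsE by blast
  show ?thesis
  proof (cases "norm (x l - x k) \<le> r k")
    case True
    then have "l \<in> S" using closed l by auto
    then show ?thesis
      using True l assms \<kappa>_le[OF l(1)] \<mu>_le[OF l(1)] \<kappa>_pos
      by (auto simp: step_in_range intro!: convexD)
  next
    case False
    then show ?thesis using l assms by (simp add: step_out_of_range)
  qed
next
  case False
  then show ?thesis using assms by (simp add: DW_step_def)
qed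

section \<open>One agent gathers the others\<close>

definition sweep :: "nat \<Rightarrow> nat \<Rightarrow> nat list \<Rightarrow> nat set list" where
  "sweep i K ks = concat (map (\<lambda>k. replicate (Suc K) {i, k}) ks)"

text \<open>
  In this context the leader \<open>i\<close> starts at \<open>p\<close>, and \<open>\<gamma>\<close> is the weight on \<open>p\<close> that it is going to
  retain throughout.  All positions stay in the convex set \<open>H\<close> of diameter at most \<open>B\<close>, and \<open>A\<close>
  bounds the distances from \<open>p\<close>.  The inequality between \<open>\<gamma>\<close>, \<open>A\<close>, \<open>B\<close> and \<open>r i\<close> keeps the leader in
  range of every position in \<open>H\<close>; since \<open>A\<close> may be smaller than \<open>B\<close>, it allows a diameter \<open>B\<close>
  slightly above \<open>r i\<close>, which is needed just after two classes have come into contact.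
\<close>

context
  fixes H :: "(real ^ 'd) set" and p :: "real ^ 'd" and S :: "nat set" and i :: nat
    and A B \<gamma> :: real
  assumes H: "convex H" "p \<in> H"
    and pA: "\<And>y. y \<in> H \<Longrightarrow> norm (p - y) \<le> A"
    and HB: "\<And>y z. y \<in> H \<Longrightarrow> z \<in> H \<Longrightarrow> norm (y - z) \<le> B"
    and S: "S \<subseteq> agents n" "i \<in> S"
    and AB: "A \<le> B" "0 \<le> \<gamma>" "\<gamma> * A + (1 - \<gamma>) * B \<le> r i"
begin

lemma leader_in_range:
  assumes "u \<in> toward p a H" "v \<in> H" "\<gamma> \<le> a" "a \<le> 1"
  shows "norm (u - v) \<le> r i"
proof -
  have "norm (u - v) \<le> a * A + (1 - a) * B"
    using dist_toward[OF assms(1,2) _ _ pA HB] assms AB by auto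
  also have "\<dots> \<le> \<gamma> * A + (1 - \<gamma>) * B"
    using mult_right_mono[OF assms(3), of "B - A"] AB by (simp add: algebra_simps)
  finally show ?thesis using AB by linarith
qed

text \<open>An agent keeps at least the fraction \<open>\<kappa>\<close> of its own position, hence of its weight on \<open>p\<close>.\<close>

lemma toward_step:
  assumes "e \<in> agent_pairs n" "e \<subseteq> S" "k \<in> S" "x k \<in> toward p a H" "0 \<le> a" "a \<le> 1"
    and xH: "\<And>l. l \<in> S \<Longrightarrow> x l \<in> H"
  shows "step e x k \<in> toward p (\<kappa> * a) H"
proof -
  have weaken: "toward p b H \<subseteq> toward p (\<kappa> * a) H" if "\<kappa> * a \<le> b" "b \<le> 1" for b
    by (rule toward_antimono[OF H that])
  have \<kappa>a: "\<kappa> * a \<le> a" using \<kappa>_less_1 assms(5) by (simp add: mult_left_le_one_le \<kappa>_pos less_imp_le)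
  have stay: "x k \<in> toward p (\<kappa> * a) H"
    using weaken[OF \<kappa>a assms(6)] assms(4) by blast
  show ?thesis
  proof (cases "k \<in> e")
    case True
    then obtain l where l: "k \<in> agents n" "l \<in> agents n" "k \<noteq> l" "e = {k, l}"
      using assms(1) agent_pairsE by blast
    show ?thesis
    proof (cases "norm (x l - x k) \<le> r k")
      case True
      note \<mu> = \<kappa>_le[OF l(1)] \<mu>_le[OF l(1)] \<kappa>_pos
      have "x l \<in> toward p 0 H" using xH l assms(2) by auto
      then have "step e x k \<in> toward p ((1 - \<mu> k) * a + \<mu> k * 0) H"
        using toward_mix[OF H(1) assms(4), of "x l" 0 "\<mu> k"] l True assms(6) \<mu>
        by (auto simp: step_in_range)
      moreover have "\<kappa> * a \<le> (1 - \<mu> k) * a" using \<mu> assms(5) by (intro mult_right_mono) auto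
      moreover have "(1 - \<mu> k) * a \<le> 1" using \<mu> assms(5,6) mult_le_one[of "1 - \<mu> k" a] by auto
      ultimately show ?thesis using weaken by auto
    next
      case False
      then show ?thesis using l stay by (simp add: step_out_of_range)
    qed
  next
    case False
    then show ?thesis using stay by (simp add: DW_step_def)
  qed
qed

text \<open>
  An agent that has the leader in its range moves at least the fraction \<open>\<kappa>\<close> of the way to it, and so
  acquires a weight on \<open>p\<close> regardless of where it was.
\<close>

lemma pulled_step:
  assumes "k \<in> S" "k \<noteq> i" "x i \<in> toward p a H" "0 \<le> a" "a \<le> 1" "x k \<in> H"
    and near: "norm (x i - x k) \<le> r k"
  shows "step {i, k} x k \<in> toward p (\<kappa> * a) H"
proof -
  have k: "k \<in> agents n" using assms S by auto
  note \<mu> = \<kappa>_le[OF k] \<mu>_le[OF k] \<kappa>_pos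
  have "step {i, k} x k = (1 - \<mu> k) *\<^sub>R x k + \<mu> k *\<^sub>R x i"
    using step_in_range[OF assms(2) near] by (simp add: insert_commute)
  then have "step {i, k} x k \<in> toward p ((1 - \<mu> k) * 0 + \<mu> k * a) H"
    using toward_mix[OF H(1) _ assms(3), of "x k" 0 "\<mu> k"] assms \<mu> by auto
  moreover have "\<kappa> * a \<le> \<mu> k * a" using \<mu> assms(4) by (intro mult_right_mono) auto
  moreover have "\<mu> k * a \<le> 1" using \<mu> assms(4,5) mult_le_one[of "\<mu> k" a] by auto
  ultimately show ?thesis using toward_antimono[OF H, of "\<kappa> * a" "\<mu> k * a"] by auto
qed

text \<open>
  As long as \<open>k\<close> does not respond, the leader approaches it geometrically.  Hence \<open>k\<close> responds at the
  latest when the distance has dropped below \<open>\<rho> \<le> r k\<close>, that is after \<open>K\<close> selections; the last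
  of the \<open>Suc K\<close> selections then pulls \<open>k\<close>.
\<close>

lemma repeat_pair:
  assumes k: "k \<in> S" "k \<noteq> i" and xi: "x i \<in> toward p a H"
    and a: "\<gamma> \<le> a * \<kappa> ^ K" "0 \<le> a" "a \<le> 1"
    and xH: "\<And>l. l \<in> S \<Longrightarrow> x l \<in> H"
    and K: "(1 - \<kappa>) ^ K * B \<le> \<rho>"
  defines "y \<equiv> run (replicate (Suc K) {i, k}) x"
  shows "\<And>l. l \<in> S \<Longrightarrow> y l \<in> H"
    and "y k \<in> toward p (a * \<kappa> ^ Suc K) H"
    and "\<And>l. l \<in> S \<Longrightarrow> x l \<in> toward p a H \<Longrightarrow> y l \<in> toward p (a * \<kappa> ^ Suc K) H"
    and "\<And>l. l \<notin> S \<Longrightarrow> y l = x l"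
proof -
  let ?e = "{i, k}"
  have e: "?e \<in> agent_pairs n" "?e \<subseteq> S" using k S by (auto intro!: agent_pairsI)
  define z where "z j = run (replicate j ?e) x" for j
  have z0: "z 0 = x" by (simp add: z_def)
  have zSuc: "z (Suc j) = step ?e (z j)" for j
    unfolding z_def replicate_append_same[symmetric] replicate_Suc by simp
  have pow: "0 \<le> a * \<kappa> ^ j" "a * \<kappa> ^ j \<le> 1" for j
    using a \<kappa>_pos \<kappa>_less_1 by (auto intro!: mult_le_one power_le_one)
  have zH: "z j l \<in> H" if "l \<in> S" for j l
    using that
  proof (induction j arbitrary: l)
    case (Suc j)
    then show ?case
      unfolding zSuc using e(2) by (intro step_in_convex[OF H(1) e(1)]) auto
  qed (simp add: z0 xH)
  have zT: "z j l \<in> toward p (a * \<kappa> ^ j) H" if "l \<in> S" "x l \<in> toward p a H" for j l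
  proof (induction j)
    case (Suc j)
    then show ?case
      unfolding zSuc using toward_step[where x="z j", OF e that(1) Suc pow zH]
      by (simp add: algebra_simps)
  qed (simp add: z0 that)
  (* Either k has already been pulled, or the leader has been closing in on it. *)
  have zk: "z j k \<in> toward p (a * \<kappa> ^ j) H \<or> norm (z j i - z j k) \<le> (1 - \<kappa>) ^ j * B"
    if "j \<le> K" for j
    using that
  proof (induction j)
    case 0
    show ?case using HB xH k S by (auto simp: z0)
  next
    case (Suc j)
    show ?case
    proof (cases "z j k \<in> toward p (a * \<kappa> ^ j) H \<or> norm (z j i - z j k) \<le> r k")
      case True
      then have "z (Suc j) k \<in> toward p (\<kappa> * (a * \<kappa> ^ j)) H"
        unfolding zSuc using toward_step[where x="z j", OF e k(1) _ pow zH]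
          pulled_step[where x="z j", OF k zT[OF S(2) xi] pow zH[OF k(1)]] by blast
      then show ?thesis by (simp add: algebra_simps)
    next
      case False
      have "\<gamma> \<le> a * \<kappa> ^ j"
        using a(1) mult_left_mono[OF power_decreasing[of j K \<kappa>], of a] Suc.prems a(2) \<kappa>_pos \<kappa>_less_1
        by auto
      then have "norm (z j i - z j k) \<le> r i"
        using leader_in_range[OF zT[OF S(2) xi] zH[OF k(1)]] pow by auto
      then have i': "step ?e (z j) i = (1 - \<mu> i) *\<^sub>R z j i + \<mu> i *\<^sub>R z j k"
        using k(2) by (intro step_in_range) (auto simp: norm_minus_commute)
      have k': "step ?e (z j) k = z j k"
        using step_out_of_range[of k i "z j"] k(2) False by (simp add: insert_commute)
      have "z (Suc j) i - z (Suc j) k = (1 - \<mu> i) *\<^sub>R (z j i - z j k)"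
        unfolding zSuc i' k' by (simp add: algebra_simps)
      then have "norm (z (Suc j) i - z (Suc j) k) = (1 - \<mu> i) * norm (z j i - z j k)"
        using S \<mu>_le[of i] \<kappa>_pos by auto
      also have "\<dots> \<le> (1 - \<kappa>) * ((1 - \<kappa>) ^ j * B)"
        using False Suc S \<kappa>_le[of i] \<kappa>_less_1 by (intro mult_mono) auto
      finally show ?thesis by simp
    qed
  qed
  have "norm (z K i - z K k) \<le> r k" if "\<not> z K k \<in> toward p (a * \<kappa> ^ K) H"
    using zk[of K] that K \<rho>_le[of k] k S by auto
  then have "z (Suc K) k \<in> toward p (\<kappa> * (a * \<kappa> ^ K)) H"
    unfolding zSuc using toward_step[where x="z K", OF e k(1) _ pow zH]
      pulled_step[where x="z K", OF k zT[OF S(2) xi] pow zH[OF k(1)]] by blast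
  then show "y k \<in> toward p (a * \<kappa> ^ Suc K) H"
    unfolding y_def z_def[symmetric] by (simp add: algebra_simps)
  show "\<And>l. l \<in> S \<Longrightarrow> y l \<in> H"
    and "\<And>l. l \<in> S \<Longrightarrow> x l \<in> toward p a H \<Longrightarrow> y l \<in> toward p (a * \<kappa> ^ Suc K) H"
    unfolding y_def z_def[symmetric] by (rule zH zT; assumption)+
  have "z j l = x l" if "l \<notin> S" for j l
    using that e(2) by (induction j) (auto simp: z0 zSuc DW_step_def)
  then show "\<And>l. l \<notin> S \<Longrightarrow> y l = x l"
    unfolding y_def z_def[symmetric] by blast
qed

text \<open>
  Weights on \<open>p\<close> never vanish once acquired, and the leader itself starts with weight 1.  So the
  agents can be pulled one after the other.
\<close>

lemma sweep_toward:
  assumes "set ks \<subseteq> S - {i}" "x i = p" and xH: "\<And>l. l \<in> S \<Longrightarrow> x l \<in> H"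
    and K: "(1 - \<kappa>) ^ K * B \<le> \<rho>" and \<gamma>: "\<gamma> \<le> \<kappa> ^ (Suc K * length ks)"
  defines "y \<equiv> run (sweep i K ks) x"
  shows "(\<forall>l\<in>S. y l \<in> H) \<and> (\<forall>l\<in>insert i (set ks). y l \<in> toward p (\<kappa> ^ (Suc K * length ks)) H)
    \<and> (\<forall>l. l \<notin> S \<longrightarrow> y l = x l)"
  using assms(1) \<gamma> unfolding y_def
proof (induction ks rule: rev_induct)
  case Nil
  then show ?case using assms(2) xH H self_in_toward_1 by (auto simp: sweep_def)
next
  case (snoc k ks)
  let ?N = "Suc K * length ks"
  define z where "z = run (sweep i K ks) x"
  have N: "\<gamma> \<le> \<kappa> ^ ?N * \<kappa> ^ K"
  proof -
    have "\<kappa> ^ (Suc K * length (ks @ [k])) \<le> \<kappa> ^ (?N + K)"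
      using \<kappa>_pos \<kappa>_less_1 by (intro power_decreasing) auto
    then show ?thesis using snoc.prems(2) by (simp add: power_add)
  qed
  moreover have "\<kappa> ^ ?N * \<kappa> ^ K \<le> \<kappa> ^ ?N"
    using \<kappa>_pos \<kappa>_less_1 by (simp add: mult_right_le_one_le power_le_one)
  ultimately have IH: "\<And>l. l \<in> S \<Longrightarrow> z l \<in> H" "\<And>l. l \<notin> S \<Longrightarrow> z l = x l"
    "\<And>l. l \<in> insert i (set ks) \<Longrightarrow> z l \<in> toward p (\<kappa> ^ ?N) H"
    using snoc unfolding z_def by fastforce+
  have k: "k \<in> S" "k \<noteq> i" using snoc.prems by auto
  have pow: "0 \<le> \<kappa> ^ ?N" "\<kappa> ^ ?N \<le> 1" using \<kappa>_pos \<kappa>_less_1 by (auto intro!: power_le_one)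
  have y: "run (sweep i K (ks @ [k])) x = run (replicate (Suc K) {i, k}) z"
    by (simp add: sweep_def z_def)
  have exp: "\<kappa> ^ ?N * \<kappa> ^ Suc K = \<kappa> ^ (Suc K * length (ks @ [k]))"
    unfolding power_add[symmetric] by (simp add: algebra_simps)
  note after = repeat_pair[where x=z and K=K, OF k IH(3)[OF insertI1] N pow IH(1) K, unfolded exp]
  show ?case
    unfolding y
  proof (intro conjI ballI allI impI)
    fix l assume "l \<in> insert i (set (ks @ [k]))"
    then consider "l = k" | "l \<in> insert i (set ks)" by auto
    then show "run (replicate (Suc K) {i, k}) z l \<in> toward p (\<kappa> ^ (Suc K * length (ks @ [k]))) H"
    proof cases
      case 2
      then show ?thesis using after(3)[of l] IH(3)[of l] snoc.prems(1) S(2) by auto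
    qed (use after(2) in auto)
  qed (use after(1,4) IH in auto)
qed

end


text \<open>
  Each pair of a sweep is repeated \<open>Suc repeats\<close> times.  The number is chosen for sets of diameter up to
  \<open>2 * R\<close>, which leaves room for two classes in contact.
\<close>

definition repeats :: nat where
  "repeats = (SOME K. (1 - \<kappa>) ^ K * (2 * R) \<le> \<rho>)"

text \<open>The weight on the initial position of the leader that every agent has after a sweep, at least.\<close>

definition \<gamma> :: real where
  "\<gamma> = \<kappa> ^ (Suc repeats * n)"

lemma R_pos: "0 < R"
  using \<rho>_pos \<rho>_le_R by linarith

lemma repeats: "(1 - \<kappa>) ^ repeats * (2 * R) \<le> \<rho>"
proof -
  obtain K where "(1 - \<kappa>) ^ K < \<rho> / (2 * R)"
    using real_arch_pow_inv[of "\<rho> / (2 * R)" "1 - \<kappa>"] \<rho>_pos R_pos \<kappa>_pos by auto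
  then have "(1 - \<kappa>) ^ K * (2 * R) \<le> \<rho>"
    using R_pos by (simp add: field_simps)
  then show ?thesis
    unfolding repeats_def by (rule someI)
qed

lemma \<gamma>_pos: "0 < \<gamma>" and \<gamma>_le_1: "\<gamma> \<le> 1"
  using \<kappa>_pos \<kappa>_less_1 by (auto simp: \<gamma>_def intro!: power_le_one)

text \<open>
  After the sweep all agents of \<open>S\<close> have weight at least \<open>\<gamma>\<close> on the one point \<open>x i\<close>.  The initial
  positions enter only through \<open>H\<close>, which may be larger than their hull; this allows \<open>H\<close> to be
  the hull at an earlier time.
\<close>

lemma exists_sweep:
  assumes H: "convex H" and S: "S \<subseteq> agents n" "i \<in> S" and xH: "\<And>l. l \<in> S \<Longrightarrow> x l \<in> H"
    and A: "\<And>y. y \<in> H \<Longrightarrow> norm (x i - y) \<le> A"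
    and B: "\<And>y z. y \<in> H \<Longrightarrow> z \<in> H \<Longrightarrow> norm (y - z) \<le> B"
    and AB: "A \<le> B" "B \<le> 2 * R" "\<gamma> * A + (1 - \<gamma>) * B \<le> r i"
  obtains w where "set w \<subseteq> agent_pairs n" "length w \<le> Suc repeats * n"
    "\<And>l. l \<in> S \<Longrightarrow> run w x l \<in> H"
    "\<And>k l. k \<in> S \<Longrightarrow> l \<in> S \<Longrightarrow> norm (run w x k - run w x l) \<le> (1 - \<gamma>) * B"
    "\<And>l. l \<notin> S \<Longrightarrow> run w x l = x l"
proof -
  define ks where "ks = sorted_list_of_set (S - {i})"
  have fin: "finite S" using S by (auto intro: finite_subset simp: agents_def)
  then have ks: "set ks = S - {i}" by (simp add: ks_def)
  have "length ks = card (S - {i})" by (simp add: ks_def)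
  also have "\<dots> \<le> card (agents n)" using S by (intro card_mono) (auto simp: agents_def)
  finally have len: "length ks \<le> n" by (simp add: agents_def)
  then have len': "Suc repeats * length ks \<le> Suc repeats * n" by (rule mult_le_mono2)
  have \<gamma>_le: "\<gamma> \<le> \<kappa> ^ (Suc repeats * length ks)"
    unfolding \<gamma>_def using len' \<kappa>_pos \<kappa>_less_1 by (intro power_decreasing) auto
  have pH: "x i \<in> H" using xH S by auto
  have "(1 - \<kappa>) ^ repeats * B \<le> (1 - \<kappa>) ^ repeats * (2 * R)"
    using AB(2) \<kappa>_less_1 by (intro mult_left_mono) auto
  then have K: "(1 - \<kappa>) ^ repeats * B \<le> \<rho>" using repeats by linarith
  let ?w = "sweep i repeats ks" and ?a = "\<kappa> ^ (Suc repeats * length ks)"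
  note T = sweep_toward[where x=x, OF H pH A B S AB(1) _ AB(3) _ _ xH K \<gamma>_le]
  have T: "(\<forall>l\<in>S. run ?w x l \<in> H) \<and> (\<forall>l\<in>insert i (set ks). run ?w x l \<in> toward (x i) ?a H)
    \<and> (\<forall>l. l \<notin> S \<longrightarrow> run ?w x l = x l)"
    by (rule T) (use \<gamma>_pos ks in auto)
  have a: "?a \<le> 1" using \<kappa>_pos \<kappa>_less_1 by (intro power_le_one) auto
  have "0 \<le> B" using B[OF pH pH] by simp
  show thesis
  proof (rule that[of ?w])
    have "{i, k} \<in> agent_pairs n" if "k \<in> set ks" for k
      using that ks S by (intro agent_pairsI) auto
    then show "set ?w \<subseteq> agent_pairs n" by (auto simp: sweep_def)
    have "length ?w = Suc repeats * length ks"
      by (simp add: sweep_def length_concat comp_def sum_list_triv del: replicate_Suc)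
    then show "length ?w \<le> Suc repeats * n" using len' by simp
    fix k l assume "k \<in> S" "l \<in> S"
    then have "norm (run ?w x k - run ?w x l) \<le> (1 - ?a) * B"
      using dist_toward_toward[of "run ?w x k" "x i" ?a H "run ?w x l" B] T ks a B by auto
    also have "\<dots> \<le> (1 - \<gamma>) * B"
      using \<gamma>_le \<open>0 \<le> B\<close> by (intro mult_right_mono) auto
    finally show "norm (run ?w x k - run ?w x l) \<le> (1 - \<gamma>) * B" .
  qed (use T in auto)
qed

text \<open>
  If the diameter of \<open>S\<close> does not exceed \<open>r i\<close>, then \<open>i\<close> is in range of everybody, and this remains
  so after a sweep because the diameter has not grown.  Sweeps can therefore be iterated.
\<close>

lemma exists_gathering:
  assumes S: "S \<subseteq> agents n" "i \<in> S"
    and B: "\<And>k l. k \<in> S \<Longrightarrow> l \<in> S \<Longrightarrow> norm (x k - x l) \<le> B" "B \<le> r i"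
  shows "\<exists>w. set w \<subseteq> agent_pairs n \<and> length w \<le> q * (Suc repeats * n)
    \<and> (\<forall>k\<in>S. \<forall>l\<in>S. norm (run w x k - run w x l) \<le> (1 - \<gamma>) ^ q * B)
    \<and> (\<forall>l. l \<notin> S \<longrightarrow> run w x l = x l)"
proof (induction q)
  case 0
  show ?case using B by (intro exI[of _ "[]"]) auto
next
  case (Suc q)
  then obtain w where w: "set w \<subseteq> agent_pairs n" "length w \<le> q * (Suc repeats * n)"
    "\<And>k l. k \<in> S \<Longrightarrow> l \<in> S \<Longrightarrow> norm (run w x k - run w x l) \<le> (1 - \<gamma>) ^ q * B"
    "\<And>l. l \<notin> S \<Longrightarrow> run w x l = x l"
    by blast
  let ?B = "(1 - \<gamma>) ^ q * B" and ?H = "convex hull (run w x ` S)"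
  have H: "norm (y - z) \<le> ?B" if "y \<in> ?H" "z \<in> ?H" for y z
    using that by (rule norm_convex_hull_le[rotated]) (use w(3) in auto)
  have "0 \<le> B" using B(1)[OF S(2) S(2)] by simp
  then have "?B \<le> B" using \<gamma>_pos \<gamma>_le_1 by (simp add: mult_left_le_one_le power_le_one)
  then have B': "?B \<le> r i" "?B \<le> 2 * R" using B r_le[of i] S R_pos by auto
  have xH: "run w x l \<in> ?H" if "l \<in> S" for l using that by (intro hull_inc) auto
  obtain v where v: "set v \<subseteq> agent_pairs n" "length v \<le> Suc repeats * n"
    "\<And>k l. k \<in> S \<Longrightarrow> l \<in> S \<Longrightarrow> norm (run v (run w x) k - run v (run w x) l) \<le> (1 - \<gamma>) * ?B"
    "\<And>l. l \<notin> S \<Longrightarrow> run v (run w x) l = run w x l"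
    by (rule exists_sweep[where x="run w x" and H="?H" and A="?B" and B="?B", OF convex_convex_hull S])
      (use H xH S B' in \<open>auto simp: algebra_simps\<close>)
  show ?case
    by (intro exI[of _ "w @ v"]) (use w v in \<open>auto simp: algebra_simps\<close>)
qed

section \<open>Merging two classes of agents\<close>

text \<open>A partition of the agents into classes is given by a colouring \<open>c\<close>.\<close>

definition tight :: "(nat \<Rightarrow> nat) \<Rightarrow> real \<Rightarrow> (nat \<Rightarrow> real ^ 'd) \<Rightarrow> bool" where
  "tight c \<delta> x \<longleftrightarrow> (\<forall>i\<in>agents n. \<forall>j\<in>agents n. c i = c j \<longrightarrow> norm (x i - x j) \<le> \<delta>)"

definition separated :: "(nat \<Rightarrow> nat) \<Rightarrow> (nat \<Rightarrow> real ^ 'd) \<Rightarrow> bool" where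
  "separated c x \<longleftrightarrow> (\<forall>i\<in>agents n. \<forall>j\<in>agents n. c i \<noteq> c j \<longrightarrow> r i < norm (x i - x j))"

text \<open>
  The two classes in contact may together have a diameter of up to \<open>r i + 2 * \<delta>\<close>, slightly more than
  the agent \<open>i\<close> can see.  One interaction with \<open>j\<close> puts \<open>i\<close> between the two classes, within
  \<open>(1 - \<kappa>) * r i + 2 * \<delta>\<close> of all of them.  For small \<open>\<delta>\<close> this suffices for one sweep, after which the
  diameter is at most \<open>r i\<close>, and \<open>q\<close> further sweeps reduce it to \<open>\<delta>\<close>.  The other classes
  do not move meanwhile.
\<close>

lemma merge_blocks:
  assumes c: "c \<in> agents n \<rightarrow>\<^sub>E agents n" and x: "tight c \<delta> x" "\<not> separated c x"
    and \<delta>: "2 * \<delta> \<le> \<gamma> * \<kappa> * \<rho>" and q: "(1 - \<gamma>) ^ q * R \<le> \<delta>"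
  obtains w c' where "set w \<subseteq> agent_pairs n" "length w \<le> Suc (Suc q * (Suc repeats * n))"
    "c' \<in> agents n \<rightarrow>\<^sub>E agents n" "tight c' \<delta> (run w x)" "card (c' ` agents n) < card (c ` agents n)"
proof -
  obtain i j where i: "i \<in> agents n" and j: "j \<in> agents n" and ij: "c i \<noteq> c j"
    and range: "norm (x j - x i) \<le> r i"
    using x(2) by (auto simp: separated_def not_less norm_minus_commute)
  define S where "S = {k \<in> agents n. c k = c i \<or> c k = c j}"
  have S: "S \<subseteq> agents n" "i \<in> S" "j \<in> S" using i j by (auto simp: S_def)
  have same: "norm (x k - x l) \<le> \<delta>" if "k \<in> agents n" "l \<in> agents n" "c k = c l" for k l
    using x(1) that by (auto simp: tight_def)
  have \<delta>0: "0 \<le> \<delta>" using same[OF i i] by simp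
  note const = \<kappa>_pos \<kappa>_less_1 \<gamma>_pos \<gamma>_le_1 \<rho>_pos \<rho>_le[OF i] r_le[OF i] \<kappa>_le[OF i] \<mu>_le[OF i]
  (* B bounds the diameter of the union S, and A the distances in S from the new position p of i. *)
  define B where "B = r i + 2 * \<delta>"
  define A where "A = (1 - \<kappa>) * r i + 2 * \<delta>"
  define p where "p = step {i, j} x i"
  have p: "p = (1 - \<mu> i) *\<^sub>R x i + \<mu> i *\<^sub>R x j"
    unfolding p_def using range ij by (intro step_in_range) auto
  have near: "norm (x k - x i) \<le> \<delta> \<or> norm (x k - x j) \<le> \<delta>" if "k \<in> S" for k
    using that same i j by (auto simp: S_def)
  have diam: "norm (x k - x l) \<le> B" if "k \<in> S" "l \<in> S" for k l
  proof -
    have "norm (x k - x l) \<le> norm (x k - x i) + norm (x l - x i)"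
      "norm (x k - x l) \<le> norm (x k - x j) + norm (x l - x j)"
      "norm (x k - x l) \<le> norm (x k - x i) + norm (x j - x i) + norm (x l - x j)"
      "norm (x k - x l) \<le> norm (x k - x j) + norm (x j - x i) + norm (x l - x i)"
      by norm+
    then show ?thesis using near[OF that(1)] near[OF that(2)] range const \<delta>0
      unfolding B_def by argo
  qed
  have rad: "norm (p - x k) \<le> A" if "k \<in> S" for k
  proof -
    have *: "t * norm (x j - x i) \<le> (1 - \<kappa>) * r i" if "t \<le> 1 - \<kappa>" "0 \<le> t" for t
      using range that const by (intro mult_mono) auto
    have pk1: "p - x k = \<mu> i *\<^sub>R (x j - x i) + (x i - x k)"
      unfolding p by (simp add: algebra_simps)
    have 1: "norm (p - x k) \<le> \<mu> i * norm (x j - x i) + norm (x k - x i)"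
      unfolding pk1 using norm_triangle_ineq[of "\<mu> i *\<^sub>R (x j - x i)" "x i - x k"] const
      by (simp add: norm_minus_commute)
    have pk2: "p - x k = (1 - \<mu> i) *\<^sub>R (x i - x j) + (x j - x k)"
      unfolding p by (simp add: algebra_simps)
    have 2: "norm (p - x k) \<le> (1 - \<mu> i) * norm (x j - x i) + norm (x k - x j)"
      unfolding pk2 using norm_triangle_ineq[of "(1 - \<mu> i) *\<^sub>R (x i - x j)" "x j - x k"] const
      by (simp add: norm_minus_commute)
    show ?thesis using 1 2 near[OF that] *[of "\<mu> i"] *[of "1 - \<mu> i"] const \<delta>0
      unfolding A_def by argo
  qed
  define H where "H = convex hull (x ` S)"
  have H: "convex H" by (simp add: H_def)
  have xH: "x l \<in> H" if "l \<in> S" for l using that by (auto simp: H_def intro: hull_inc)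
  have HB: "norm (y - z) \<le> B" if "y \<in> H" "z \<in> H" for y z
    using that unfolding H_def by (rule norm_convex_hull_le[rotated]) (use diam in auto)
  have "H \<subseteq> cball p A" unfolding H_def using rad by (intro hull_minimal) (auto simp: dist_norm)
  then have HA: "norm (step {i, j} x i - y) \<le> A" if "y \<in> H" for y
    using that by (auto simp: dist_norm p_def)
  have e: "{i, j} \<in> agent_pairs n" using i j ij by (intro agent_pairsI) auto
  have sH: "step {i, j} x l \<in> H" if "l \<in> S" for l
    using that S by (intro step_in_convex[OF H e that xH]) auto
  have "\<kappa> * \<rho> \<le> \<rho>" using const by (intro mult_left_le_one_le) auto
  then have \<kappa>r: "\<kappa> * \<rho> \<le> \<kappa> * r i" "\<kappa> * \<rho> \<le> r i"
    using const by (simp, linarith)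
  have "2 * \<delta> \<le> \<gamma> * (\<kappa> * \<rho>)" using \<delta> by (simp add: mult.assoc)
  moreover have "\<gamma> * (\<kappa> * \<rho>) \<le> \<gamma> * (\<kappa> * r i)" "\<gamma> * (\<kappa> * \<rho>) \<le> \<gamma> * r i"
    using \<kappa>r const by (intro mult_left_mono; simp)+
  ultimately have \<gamma>r: "2 * \<delta> \<le> \<gamma> * (\<kappa> * r i)" "2 * \<delta> \<le> \<gamma> * r i" by linarith+
  have AB: "A \<le> B" using const by (simp add: A_def B_def algebra_simps)
  have "\<gamma> * r i \<le> r i" using const by (simp add: mult_left_le_one_le)
  then have B2: "B \<le> 2 * R" using \<gamma>r const unfolding B_def by linarith
  have "\<gamma> * A + (1 - \<gamma>) * B = r i - \<gamma> * (\<kappa> * r i) + 2 * \<delta>"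
    by (simp add: A_def B_def algebra_simps)
  then have AB': "\<gamma> * A + (1 - \<gamma>) * B \<le> r i" using \<gamma>r by linarith
  obtain v where v: "set v \<subseteq> agent_pairs n" "length v \<le> Suc repeats * n"
    "\<And>k l. k \<in> S \<Longrightarrow> l \<in> S \<Longrightarrow> norm (run v (step {i, j} x) k - run v (step {i, j} x) l) \<le> (1 - \<gamma>) * B"
    "\<And>l. l \<notin> S \<Longrightarrow> run v (step {i, j} x) l = step {i, j} x l"
    by (rule exists_sweep[where x="step {i, j} x", OF H S(1,2) sH HA HB AB B2 AB'])
      (assumption | (rule that; blast))+
  have "(1 - \<gamma>) * B = r i - \<gamma> * r i + (1 - \<gamma>) * (2 * \<delta>)" by (simp add: B_def algebra_simps)
  also have "\<dots> \<le> r i" using \<gamma>r \<delta>0 const mult_left_le_one_le[of "2 * \<delta>" "1 - \<gamma>"] by auto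
  finally have B': "(1 - \<gamma>) * B \<le> r i" .
  let ?y = "run v (step {i, j} x)"
  obtain u where u: "set u \<subseteq> agent_pairs n" "length u \<le> q * (Suc repeats * n)"
    "\<And>k l. k \<in> S \<Longrightarrow> l \<in> S \<Longrightarrow> norm (run u ?y k - run u ?y l) \<le> (1 - \<gamma>) ^ q * ((1 - \<gamma>) * B)"
    "\<And>l. l \<notin> S \<Longrightarrow> run u ?y l = ?y l"
    using exists_gathering[where x="?y", OF S(1,2) v(3) B', of q] by blast
  have "(1 - \<gamma>) ^ q * ((1 - \<gamma>) * B) \<le> (1 - \<gamma>) ^ q * R"
    using B' const by (intro mult_left_mono) auto
  then have gathered: "norm (run u ?y k - run u ?y l) \<le> \<delta>" if "k \<in> S" "l \<in> S" for k l
    using u(3)[OF that] q by linarith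
  have outside: "run u ?y l = x l" if "l \<notin> S" for l
    using that u(4) v(4) S by (auto simp: DW_step_def)
  define c' where "c' k = (if k \<in> agents n \<and> c k = c j then c i else c k)" for k
  show thesis
  proof (rule that[of "{i, j} # v @ u" c'])
    show "set ({i, j} # v @ u) \<subseteq> agent_pairs n" using e v u by auto
    show "length ({i, j} # v @ u) \<le> Suc (Suc q * (Suc repeats * n))" using v(2) u(2) by simp
    show "c' \<in> agents n \<rightarrow>\<^sub>E agents n" using c i by (auto simp: c'_def PiE_iff extensional_def)
    have "c' ` agents n \<subseteq> c ` agents n - {c j}" using i ij by (auto simp: c'_def)
    then have "c' ` agents n \<subset> c ` agents n" using j by blast
    then show "card (c' ` agents n) < card (c ` agents n)"
      by (intro psubset_card_mono) (auto simp: agents_def)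
    show "tight c' \<delta> (run ({i, j} # v @ u) x)"
      unfolding tight_def
    proof (intro ballI impI)
      fix k l assume kl: "k \<in> agents n" "l \<in> agents n" "c' k = c' l"
      then have "k \<in> S \<longleftrightarrow> l \<in> S" by (auto simp: c'_def S_def split: if_splits)
      moreover have "c k = c l" if "k \<notin> S" "l \<notin> S"
        using kl that by (auto simp: c'_def S_def)
      ultimately show "norm (run ({i, j} # v @ u) x k - run ({i, j} # v @ u) x l) \<le> \<delta>"
        using gathered outside same kl by (cases "k \<in> S") auto
    qed
  qed
qed

text \<open>Without contacts between classes, each class stays in its own convex hull.\<close>

lemma step_tight:
  assumes "tight c \<delta> x" "separated c x" "e \<in> agent_pairs n"
  shows "tight c \<delta> (step e x)"
  unfolding tight_def
proof (intro ballI impI)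
  fix i j assume ij: "i \<in> agents n" "j \<in> agents n" "c i = c j"
  define S where "S = {k \<in> agents n. c k = c i}"
  let ?H = "convex hull (x ` S)"
  have "step e x k \<in> ?H" if "k \<in> S" for k
    using assms(2,3) that
    by (intro step_in_convex[OF convex_convex_hull assms(3) that])
      (auto simp: S_def separated_def not_less norm_minus_commute agent_pairs_def
        intro!: hull_inc, (metis not_less norm_minus_commute)+)
  then have "step e x i \<in> ?H" "step e x j \<in> ?H" using ij by (auto simp: S_def)
  then show "norm (step e x i - step e x j) \<le> \<delta>"
    by (rule norm_convex_hull_le[rotated]) (use assms(1) in \<open>auto simp: S_def tight_def\<close>)
qed



section \<open>The random trajectory\<close>

abbreviation traj :: "(nat \<Rightarrow> real ^ 'd) \<Rightarrow> (nat \<Rightarrow> nat set) \<Rightarrow> nat \<Rightarrow> nat \<Rightarrow> real ^ 'd" where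
  "traj \<equiv> DW_opinion r \<mu>"

abbreviation M :: "(nat \<Rightarrow> nat set) measure" where "M \<equiv> DW_measure n"

lemma traj_case_nat: "traj x (case_nat e \<omega>) (Suc t) = traj (step e x) \<omega> t"
  by (induction t) simp_all

lemma selection_in_pairs: "\<omega> \<in> space M \<Longrightarrow> \<omega> t \<in> agent_pairs n"
  by (auto simp: space_DW_measure)

text \<open>
  The state at time \<open>t\<close> depends on finitely many selections from a finite set.  It is thus a discrete
  random variable, and every property of it is measurable.
\<close>

lemma measurable_traj: "(\<lambda>\<omega>. traj x \<omega> t) \<in> M \<rightarrow>\<^sub>M count_space UNIV"
proof (induction t)
  case (Suc t)
  have "(\<lambda>\<omega>. \<omega> t) \<in> M \<rightarrow>\<^sub>M uniform_count_measure (agent_pairs n)"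
    unfolding DW_measure_def by measurable
  then have sel: "(\<lambda>\<omega>. \<omega> t) \<in> M \<rightarrow>\<^sub>M count_space (agent_pairs n)"
    by (subst (asm) measurable_cong_sets[OF refl sets_uniform_count_measure_count_space])
  have "(\<lambda>\<omega>. step e (traj x \<omega> t)) \<in> M \<rightarrow>\<^sub>M count_space UNIV" for e
    by (rule measurable_compose[OF Suc]) simp
  then have "(\<lambda>\<omega>. step (\<omega> t) (traj x \<omega> t)) \<in> M \<rightarrow>\<^sub>M count_space UNIV"
    by (rule measurable_compose_countable'[OF _ sel]) (simp add: countable_finite finite_agent_pairs)
  then show ?case by simp
qed simp

lemma measurable_traj_agent [measurable]: "(\<lambda>\<omega>. traj x \<omega> t i) \<in> borel_measurable M"
  by (rule measurable_compose[OF measurable_traj]) simp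

lemma pairs_nonempty: "agent_pairs n \<noteq> {}"
  using agent_pairs_nonempty n_ge_2 by blast

lemma prob_M: "prob_space M"
  using prob_space_DW_measure n_ge_2 by blast

lemma case_nat_in_space: "e \<in> agent_pairs n \<Longrightarrow> \<omega> \<in> space M \<Longrightarrow> case_nat e \<omega> \<in> space M"
  by (auto simp: space_DW_measure PiE_iff split: nat.split)

text \<open>
  The Markov property at time 1: the first selection is uniform and independent of the shifted
  sequence.
\<close>

lemma first_step:
  assumes Q: "Measurable.pred M Q"
  shows "measure M {\<omega> \<in> space M. Q \<omega>} =
    (\<Sum>e\<in>agent_pairs n. measure M {\<omega> \<in> space M. Q (case_nat e \<omega>)}) / card (agent_pairs n)"
proof -
  interpret prob_space M by (rule prob_M)
  let ?E = "agent_pairs n" and ?U = "uniform_count_measure (agent_pairs n)"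
  let ?f = "\<lambda>(e, \<omega>). case_nat e \<omega> :: nat \<Rightarrow> nat set" and ?V = "{\<omega> \<in> space M. Q \<omega>}"
  interpret U: prob_space ?U
    by (intro prob_space_uniform_count_measure finite_agent_pairs pairs_nonempty)
  interpret seq: sequence_space ?U by unfold_locales
  have f [measurable]: "?f \<in> ?U \<Otimes>\<^sub>M M \<rightarrow>\<^sub>M M"
    unfolding DW_measure_def by measurable
  have V: "?V \<in> sets M" using Q by measurable
  have "emeasure M ?V = emeasure (distr (?U \<Otimes>\<^sub>M M) M ?f) ?V"
    using seq.PiM_iter by (simp add: DW_measure_def)
  also have "\<dots> = emeasure (?U \<Otimes>\<^sub>M M) (?f -` ?V \<inter> space (?U \<Otimes>\<^sub>M M))"
    by (rule emeasure_distr[OF f V])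
  also have "\<dots> = (\<integral>\<^sup>+e. emeasure M (Pair e -` (?f -` ?V \<inter> space (?U \<Otimes>\<^sub>M M))) \<partial>?U)"
    by (rule emeasure_pair_measure_alt[OF measurable_sets[OF f V]])
  also have "\<dots> = (\<Sum>e\<in>?E. ennreal (1 / card ?E) *
      emeasure M (Pair e -` (?f -` ?V \<inter> space (?U \<Otimes>\<^sub>M M))))"
    unfolding uniform_count_measure_def
    by (rule nn_integral_point_measure_finite[OF finite_agent_pairs])
  also have "\<dots> = (\<Sum>e\<in>?E. ennreal (1 / card ?E * measure M {\<omega> \<in> space M. Q (case_nat e \<omega>)}))"
  proof (rule sum.cong[OF refl])
    fix e assume "e \<in> ?E"
    then have slice: "Pair e -` (?f -` ?V \<inter> space (?U \<Otimes>\<^sub>M M)) = {\<omega> \<in> space M. Q (case_nat e \<omega>)}"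
      by (auto simp: space_pair_measure space_uniform_count_measure case_nat_in_space)
    show "ennreal (1 / card ?E) * emeasure M (Pair e -` (?f -` ?V \<inter> space (?U \<Otimes>\<^sub>M M))) =
        ennreal (1 / card ?E * measure M {\<omega> \<in> space M. Q (case_nat e \<omega>)})"
      unfolding slice emeasure_eq_measure by (rule ennreal_mult'[symmetric]) simp
  qed
  also have "\<dots> = ennreal (\<Sum>e\<in>?E. 1 / card ?E * measure M {\<omega> \<in> space M. Q (case_nat e \<omega>)})"
    by (intro sum_ennreal) simp
  finally show ?thesis
    by (simp add: emeasure_eq_measure sum_nonneg sum_divide_distrib divide_simps)
qed

definition stable :: "(nat \<Rightarrow> nat) \<Rightarrow> real \<Rightarrow> (nat \<Rightarrow> real ^ 'd) \<Rightarrow> bool" where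
  "stable c \<delta> x \<longleftrightarrow> tight c \<delta> x \<and> separated c x"

text \<open>
  Restricting \<open>c\<close> to an extensional function space leaves finitely many colourings, which makes
  the event measurable.  Asking for stability only eventually makes it shift invariant.
\<close>

definition settles :: "real \<Rightarrow> (nat \<Rightarrow> real ^ 'd) \<Rightarrow> (nat \<Rightarrow> nat set) \<Rightarrow> bool" where
  "settles \<delta> x \<omega> \<longleftrightarrow>
     (\<exists>c\<in>agents n \<rightarrow>\<^sub>E agents n. \<forall>\<^sub>F t in sequentially. stable c \<delta> (traj x \<omega> t))"

definition unsettled_prob :: "real \<Rightarrow> (nat \<Rightarrow> real ^ 'd) \<Rightarrow> real" where
  "unsettled_prob \<delta> x = measure M {\<omega> \<in> space M. \<not> settles \<delta> x \<omega>}"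

lemma measurable_stable [measurable]: "Measurable.pred M (\<lambda>\<omega>. stable c \<delta> (traj x \<omega> t))"
  by (rule measurable_compose[OF measurable_traj]) simp

lemma settles_case_nat: "settles \<delta> x (case_nat e \<omega>) \<longleftrightarrow> settles \<delta> (step e x) \<omega>"
proof -
  have "(\<forall>\<^sub>F t in sequentially. stable c \<delta> (traj x (case_nat e \<omega>) t)) \<longleftrightarrow>
      (\<forall>\<^sub>F t in sequentially. stable c \<delta> (traj (step e x) \<omega> t))" for c
    using eventually_sequentially_Suc[of "\<lambda>t. stable c \<delta> (traj x (case_nat e \<omega>) t)"]
    by (simp only: traj_case_nat)
  then show ?thesis by (simp add: settles_def)
qed

lemma measurable_settles [measurable]: "Measurable.pred M (settles \<delta> x)"
proof -
  have "finite (agents n \<rightarrow>\<^sub>E agents n)" by (intro finite_PiE) (auto simp: agents_def)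
  then show ?thesis
    unfolding settles_def[abs_def] eventually_sequentially by measurable
qed

section \<open>Almost every trajectory settles\<close>

abbreviation pair_prob :: real where "pair_prob \<equiv> 1 / card (agent_pairs n)"

lemma card_pairs_pos: "0 < card (agent_pairs n)"
  using finite_agent_pairs pairs_nonempty by (simp add: card_gt_0_iff)

lemma pair_prob_pos: "0 < pair_prob" and pair_prob_le_1: "pair_prob \<le> 1"
  using card_pairs_pos by (simp_all add: divide_simps)

lemma unsettled_prob_first_step:
  "unsettled_prob \<delta> x = pair_prob * (\<Sum>e\<in>agent_pairs n. unsettled_prob \<delta> (step e x))"
  unfolding unsettled_prob_def by (subst first_step) (auto simp: settles_case_nat)

text \<open>
  The selections prescribed by \<open>w\<close> occur with probability \<open>pair_prob ^ length w\<close>; otherwise the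
  uniform bound \<open>s\<close> applies.
\<close>

lemma unsettled_prob_run:
  assumes s: "\<And>y :: nat \<Rightarrow> real ^ 'd. unsettled_prob \<delta> y \<le> s" and w: "set w \<subseteq> agent_pairs n"
  shows "unsettled_prob \<delta> (x :: nat \<Rightarrow> real ^ 'd) \<le>
    (1 - pair_prob ^ length w) * s + pair_prob ^ length w * unsettled_prob \<delta> (run w x)"
  using w
proof (induction w arbitrary: x)
  case (Cons e w)
  let ?E = "agent_pairs n" and ?u = "unsettled_prob \<delta>"
  have e: "e \<in> ?E" using Cons.prems by simp
  have "(\<Sum>a\<in>?E. ?u (step a x)) = ?u (step e x) + (\<Sum>a\<in>?E - {e}. ?u (step a x))"
    using e finite_agent_pairs by (rule sum.remove[rotated])
  also have "\<dots> \<le> ?u (step e x) + of_nat (card (?E - {e})) * s"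
    by (intro add_left_mono sum_bounded_above s)
  also have "card (?E - {e}) = card ?E - 1" using e finite_agent_pairs by simp
  also have "of_nat (card ?E - 1) = real (card ?E) - 1"
    using card_pairs_pos by (simp add: of_nat_diff)
  finally have "pair_prob * (\<Sum>a\<in>?E. ?u (step a x)) \<le> pair_prob * (?u (step e x) + (real (card ?E) - 1) * s)"
    using pair_prob_pos by (intro mult_left_mono) auto
  also have "\<dots> = (1 - pair_prob) * s + pair_prob * ?u (step e x)"
    using card_pairs_pos by (simp add: field_simps)
  finally have "?u x \<le> (1 - pair_prob) * s + pair_prob * ?u (step e x)"
    unfolding unsettled_prob_first_step[of \<delta> x] .
  also have "\<dots> \<le> (1 - pair_prob) * s + pair_prob *
      ((1 - pair_prob ^ length w) * s + pair_prob ^ length w * ?u (run w (step e x)))"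
    using Cons pair_prob_pos by (intro add_left_mono mult_left_mono) auto
  also have "\<dots> = (1 - pair_prob ^ length (e # w)) * s + pair_prob ^ length (e # w) * ?u (run (e # w) x)"
    by (simp add: algebra_simps)
  finally show ?case .
qed simp

text \<open>
  A trajectory that starts tight can only fail to settle by passing, at some random time, through a
  state in which two classes are in contact.  Up to that time the classes stay tight, so a
  bound valid for all such states also holds at the start.
\<close>

lemma unsettled_prob_le_of_tight:
  assumes c: "c \<in> agents n \<rightarrow>\<^sub>E agents n" and b: "0 \<le> b"
    and unstable: "\<And>y :: nat \<Rightarrow> real ^ 'd. tight c \<delta> y \<Longrightarrow> \<not> separated c y \<Longrightarrow> unsettled_prob \<delta> y \<le> b"
    and x: "tight c \<delta> (x :: nat \<Rightarrow> real ^ 'd)"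
  shows "unsettled_prob \<delta> x \<le> b"
proof -
  interpret prob_space M by (rule prob_M)
  (* Instability must show at a finite time if the trajectory does not settle, so the sets V T x
     exhaust that event; each of them is bounded by first-step analysis and induction on T. *)
  define V where "V T y = {\<omega> \<in> space M. \<not> settles \<delta> y \<omega> \<and> (\<exists>t<T. \<not> stable c \<delta> (traj y \<omega> t))}"
    for T and y :: "nat \<Rightarrow> real ^ 'd"
  have V_sets: "V T y \<in> sets M" for T y unfolding V_def by measurable
  have V_le: "measure M (V T y) \<le> b" if "tight c \<delta> y" for T y
    using that
  proof (induction T arbitrary: y)
    case 0
    then show ?case using b by (simp add: V_def)
  next
    case (Suc T)
    show ?case
    proof (cases "separated c y")
      case False
      have "measure M (V (Suc T) y) \<le> unsettled_prob \<delta> y"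
        unfolding unsettled_prob_def V_def by (intro finite_measure_mono) (auto, measurable)
      then show ?thesis using unstable[OF Suc.prems False] by linarith
    next
      case True
      have "{\<omega> \<in> space M. \<not> settles \<delta> y (case_nat e \<omega>) \<and>
          (\<exists>t<Suc T. \<not> stable c \<delta> (traj y (case_nat e \<omega>) t))} = V T (step e y)" for e
        using True Suc.prems unfolding Ex_less_Suc2 traj_case_nat settles_case_nat
        by (simp add: V_def stable_def)
      then have "measure M (V (Suc T) y) =
          (\<Sum>e\<in>agent_pairs n. measure M (V T (step e y))) / card (agent_pairs n)"
        unfolding V_def[of "Suc T"] by (subst first_step) auto
      also have "\<dots> \<le> (\<Sum>e\<in>agent_pairs n. b) / card (agent_pairs n)"
        using step_tight[OF Suc.prems True] Suc.IH by (intro divide_right_mono sum_mono) auto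
      finally show ?thesis using card_pairs_pos by simp
    qed
  qed
  have "incseq (\<lambda>T. V T x)"
    unfolding incseq_def V_def by (blast intro: less_le_trans)
  have "{\<omega> \<in> space M. \<not> settles \<delta> x \<omega>} = (\<Union>T. V T x)"
  proof safe
    fix \<omega> assume \<omega>: "\<omega> \<in> space M" "\<not> settles \<delta> x \<omega>"
    then obtain t where "\<not> stable c \<delta> (traj x \<omega> t)"
      using c unfolding settles_def eventually_sequentially by blast
    then have "\<omega> \<in> V (Suc t) x" using \<omega> by (auto simp: V_def)
    then show "\<omega> \<in> (\<Union>T. V T x)" by blast
  qed (auto simp: V_def)
  then have "(\<lambda>T. measure M (V T x)) \<longlonglongrightarrow> unsettled_prob \<delta> x"
    unfolding unsettled_prob_def
    using finite_Lim_measure_incseq[OF _ \<open>incseq (\<lambda>T. V T x)\<close>] V_sets by (simp add: image_subset_iff)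
  then show ?thesis
    by (rule LIMSEQ_le_const2) (use V_le[OF x] in auto)
qed

text \<open>
  At the moment of contact the prescribed selections remove a class with probability at least
  \<open>P = pair_prob ^ Suc (Suc q * (Suc repeats * n))\<close>, the exponent being the bound on their number;
  the rest of the probability is estimated by \<open>s\<close>.  There is no state with 0 classes, which starts the induction.
\<close>

lemma unsettled_prob_rank:
  fixes x :: "nat \<Rightarrow> real ^ 'd"
  assumes s: "\<And>y :: nat \<Rightarrow> real ^ 'd. unsettled_prob \<delta> y \<le> s"
    and \<delta>: "2 * \<delta> \<le> \<gamma> * \<kappa> * \<rho>" and q: "(1 - \<gamma>) ^ q * R \<le> \<delta>"
    and c: "c \<in> agents n \<rightarrow>\<^sub>E agents n" "tight c \<delta> x" "card (c ` agents n) \<le> k"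
  shows "unsettled_prob \<delta> x \<le> (1 - (pair_prob ^ Suc (Suc q * (Suc repeats * n))) ^ k) * s"
  using c
proof (induction k arbitrary: c x)
  case 0
  then show ?case using one_in_agents by (auto simp: agents_def)
next
  case (Suc k)
  define P where "P = pair_prob ^ Suc (Suc q * (Suc repeats * n))"
  have P: "0 < P" "P \<le> 1"
    using pair_prob_pos pair_prob_le_1 unfolding P_def by (auto intro!: power_le_one simp del: power_Suc)
  have s0: "0 \<le> s" using s[of x] by (auto simp: unsettled_prob_def intro: order_trans[OF measure_nonneg])
  have Pk: "0 < P ^ k" "P ^ Suc k \<le> 1" using P by (auto intro!: power_le_one simp del: power_Suc)
  show ?case
    unfolding P_def[symmetric]
  proof (rule unsettled_prob_le_of_tight[OF Suc.prems(1) _ _ Suc.prems(2)])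
    show "0 \<le> (1 - P ^ Suc k) * s" using s0 Pk by simp
    fix y :: "nat \<Rightarrow> real ^ 'd" assume y: "tight c \<delta> y" "\<not> separated c y"
    obtain w c' where w: "set w \<subseteq> agent_pairs n" "length w \<le> Suc (Suc q * (Suc repeats * n))"
      "c' \<in> agents n \<rightarrow>\<^sub>E agents n" "tight c' \<delta> (run w y)" "card (c' ` agents n) < card (c ` agents n)"
      using merge_blocks[OF Suc.prems(1) y \<delta> q] by blast
    have "card (c' ` agents n) \<le> k" using w(5) Suc.prems(3) by simp
    then have IH: "unsettled_prob \<delta> (run w y) \<le> (1 - P ^ k) * s"
      unfolding P_def by (rule Suc.IH[OF w(3,4)])
    have Pw: "P \<le> pair_prob ^ length w"
      unfolding P_def using w(2) pair_prob_pos pair_prob_le_1 by (intro power_decreasing) auto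
    have "unsettled_prob \<delta> y \<le> (1 - pair_prob ^ length w) * s +
        pair_prob ^ length w * unsettled_prob \<delta> (run w y)"
      by (rule unsettled_prob_run[OF s w(1)])
    also have "\<dots> \<le> (1 - pair_prob ^ length w) * s + pair_prob ^ length w * ((1 - P ^ k) * s)"
      using IH pair_prob_pos by (intro add_left_mono mult_left_mono) auto
    also have "\<dots> = s - pair_prob ^ length w * (P ^ k * s)" by (simp add: algebra_simps)
    also have "\<dots> \<le> s - P * (P ^ k * s)"
      using Pw Pk s0 by (intro diff_left_mono mult_right_mono) auto
    finally show "unsettled_prob \<delta> y \<le> (1 - P ^ Suc k) * s" by (simp add: algebra_simps)
  qed
qed

text \<open>
  Giving every agent its own colour bounds the rank of every state by \<open>n\<close>.  The supremum is therefore
  bounded by a proper fraction of itself.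
\<close>

lemma unsettled_prob_eq_0:
  fixes x :: "nat \<Rightarrow> real ^ 'd"
  assumes \<delta>: "0 < \<delta>" "2 * \<delta> \<le> \<gamma> * \<kappa> * \<rho>"
  shows "unsettled_prob \<delta> x = 0"
proof -
  interpret prob_space M by (rule prob_M)
  define s where "s = (SUP y :: nat \<Rightarrow> real ^ 'd. unsettled_prob \<delta> y)"
  have s: "unsettled_prob \<delta> y \<le> s" for y :: "nat \<Rightarrow> real ^ 'd"
    unfolding s_def by (intro cSUP_upper bdd_aboveI[of _ 1]) (auto simp: unsettled_prob_def)
  obtain q where "(1 - \<gamma>) ^ q < \<delta> / R"
    using real_arch_pow_inv[of "\<delta> / R" "1 - \<gamma>"] \<delta> R_pos \<gamma>_pos by auto
  then have q: "(1 - \<gamma>) ^ q * R \<le> \<delta>" using R_pos by (simp add: field_simps)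
  define P where "P = (pair_prob ^ Suc (Suc q * (Suc repeats * n))) ^ n"
  have "0 < P" using pair_prob_pos unfolding P_def by simp
  define c where "c = restrict id (agents n)"
  have c: "c \<in> agents n \<rightarrow>\<^sub>E agents n" "card (c ` agents n) \<le> n"
    by (auto simp: c_def agents_def)
  have "unsettled_prob \<delta> y \<le> (1 - P) * s" for y :: "nat \<Rightarrow> real ^ 'd"
    unfolding P_def
    by (rule unsettled_prob_rank[OF s \<delta>(2) q c(1) _ c(2)]) (use \<delta> in \<open>auto simp: tight_def c_def\<close>)
  then have "s \<le> (1 - P) * s"
    unfolding s_def[symmetric] by (subst (1) s_def) (intro cSUP_least, auto)
  then have "P * s \<le> 0" by (simp add: algebra_simps)
  then have "s \<le> 0" using \<open>0 < P\<close> by (simp add: mult_le_0_iff)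
  then show ?thesis using s[of x] by (auto simp: unsettled_prob_def intro: antisym order_trans)
qed

section \<open>Settled trajectories converge\<close>

text \<open>
  A stable colouring confines each agent to the hull spanned by its class at time \<open>t0\<close>.
\<close>

lemma stable_confines:
  assumes \<omega>: "\<omega> \<in> space M" and st: "\<And>t. t0 \<le> t \<Longrightarrow> stable c \<delta> (traj x \<omega> t)"
    and i: "i \<in> agents n" and t: "t0 \<le> t"
  shows "norm (traj x \<omega> t i - traj x \<omega> t0 i) \<le> \<delta>"
proof -
  define S where "S = {k \<in> agents n. c k = c i}"
  let ?H = "convex hull (traj x \<omega> t0 ` S)"
  have "\<forall>k\<in>S. traj x \<omega> t k \<in> ?H"
    using t
  proof (induction t rule: dec_induct)
    case (step t)
    have e: "\<omega> t \<in> agent_pairs n" using \<omega> by (rule selection_in_pairs)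
    show ?case
    proof
      fix k assume k: "k \<in> S"
      have "DW_step r \<mu> (\<omega> t) (traj x \<omega> t) k \<in> ?H"
      proof (rule step_in_convex[OF convex_convex_hull e k])
        fix l assume l: "l \<in> \<omega> t" "k \<in> \<omega> t" "norm (traj x \<omega> t l - traj x \<omega> t k) \<le> r k"
        then have "l \<in> agents n" using e by (auto simp: agent_pairs_def)
        moreover have "c k = c l"
        proof (rule ccontr)
          assume "c k \<noteq> c l"
          then have "r k < norm (traj x \<omega> t k - traj x \<omega> t l)"
            using st[OF step(1)] k \<open>l \<in> agents n\<close> by (simp add: S_def stable_def separated_def)
          then show False using l(3) by (simp add: norm_minus_commute)
        qed
        ultimately show "l \<in> S" using k by (simp add: S_def)
      qed (use step in auto)
      then show "traj x \<omega> (Suc t) k \<in> ?H" by simp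
    qed
  qed (auto intro: hull_inc)
  then have "traj x \<omega> t i \<in> ?H" "traj x \<omega> t0 i \<in> ?H"
    using i by (auto simp: S_def intro!: hull_inc)
  then show ?thesis
    by (rule norm_convex_hull_le[rotated])
      (use st[OF order_refl] in \<open>auto simp: S_def stable_def tight_def\<close>)
qed

lemma Cauchy_of_settles:
  assumes \<omega>: "\<omega> \<in> space M" and i: "i \<in> agents n"
    and st: "\<And>m::nat. settles (\<delta> m) x \<omega>" and \<delta>: "\<delta> \<longlonglongrightarrow> 0"
  shows "Cauchy (\<lambda>t. traj x \<omega> t i)"
proof (rule metric_CauchyI)
  fix e :: real assume "0 < e"
  then obtain m where m: "\<delta> m < e / 2"
    using order_tendstoD(2)[OF \<delta>, of "e / 2"] by (auto simp: eventually_sequentially)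
  obtain c t0 where t0: "\<And>t. t0 \<le> t \<Longrightarrow> stable c (\<delta> m) (traj x \<omega> t)"
    using st[of m] by (auto simp: settles_def eventually_sequentially)
  have "dist (traj x \<omega> t i) (traj x \<omega> u i) < e" if "t0 \<le> t" "t0 \<le> u" for t u
    using stable_confines[OF \<omega> t0 i that(1)] stable_confines[OF \<omega> t0 i that(2)] m
      dist_triangle2[of "traj x \<omega> t i" "traj x \<omega> u i" "traj x \<omega> t0 i"]
    by (simp add: dist_norm)
  then show "\<exists>N. \<forall>t\<ge>N. \<forall>u\<ge>N. dist (traj x \<omega> t i) (traj x \<omega> u i) < e" by blast
qed

text \<open>
  For each \<open>\<delta> m\<close> the two agents eventually share a class, and then their limits are within \<open>\<delta> m\<close>, or are
  eventually always out of range of each other.  If the second case never arises, the limits coincide.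
\<close>

lemma limits_equal_or_far:
  assumes ij: "i \<in> agents n" "j \<in> agents n"
    and lim: "(\<lambda>t. traj x \<omega> t i) \<longlonglongrightarrow> a" "(\<lambda>t. traj x \<omega> t j) \<longlonglongrightarrow> b"
    and st: "\<And>m::nat. settles (\<delta> m) x \<omega>" and \<delta>: "\<delta> \<longlonglongrightarrow> 0"
  shows "a = b \<or> max (r i) (r j) \<le> norm (a - b)"
proof (rule disjCI)
  assume far: "\<not> max (r i) (r j) \<le> norm (a - b)"
  have lim': "(\<lambda>t. norm (traj x \<omega> t i - traj x \<omega> t j)) \<longlonglongrightarrow> norm (a - b)"
    using lim by (intro tendsto_intros)
  have "norm (a - b) \<le> \<delta> m" for m
  proof -
    obtain c where c: "\<forall>\<^sub>F t in sequentially. stable c (\<delta> m) (traj x \<omega> t)"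
      using st[of m] by (auto simp: settles_def)
    show ?thesis
    proof (cases "c i = c j")
      case True
      have "\<forall>\<^sub>F t in sequentially. norm (traj x \<omega> t i - traj x \<omega> t j) \<le> \<delta> m"
        using c by eventually_elim (use True ij in \<open>auto simp: stable_def tight_def\<close>)
      then show ?thesis by (intro tendsto_upperbound[OF lim']) auto
    next
      case False
      have "\<forall>\<^sub>F t in sequentially. max (r i) (r j) \<le> norm (traj x \<omega> t i - traj x \<omega> t j)"
        using c
      proof eventually_elim
        case (elim t)
        then have "r i < norm (traj x \<omega> t i - traj x \<omega> t j)" "r j < norm (traj x \<omega> t j - traj x \<omega> t i)"
          using False ij unfolding stable_def separated_def by metis+
        then show ?case by (simp add: norm_minus_commute)
      qed
      then have "max (r i) (r j) \<le> norm (a - b)" by (intro tendsto_lowerbound[OF lim']) auto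
      then show ?thesis using far by simp
    qed
  qed
  then have "norm (a - b) \<le> 0" by (intro LIMSEQ_le_const[OF \<delta>]) auto
  then show "a = b" by simp
qed

lemma AE_settles:
  obtains \<delta> :: "nat \<Rightarrow> real" where "\<delta> \<longlonglongrightarrow> 0" "\<And>x. AE \<omega> in M. \<forall>m. settles (\<delta> m) x \<omega>"
proof -
  interpret prob_space M by (rule prob_M)
  define \<epsilon> where "\<epsilon> = \<gamma> * \<kappa> * \<rho> / 2"
  have \<epsilon>: "0 < \<epsilon>" using \<gamma>_pos \<kappa>_pos \<rho>_pos by (simp add: \<epsilon>_def)
  show thesis
  proof (rule that)
    show "(\<lambda>m. \<epsilon> / real (Suc m)) \<longlonglongrightarrow> 0"
      using tendsto_mult_right_zero[OF LIMSEQ_inverse_real_of_nat, of \<epsilon>] by (simp add: field_simps)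
    have "AE \<omega> in M. settles (\<epsilon> / real (Suc m)) x \<omega>" for m and x :: "nat \<Rightarrow> real ^ 'd"
    proof -
      have "\<epsilon> / real (Suc m) \<le> \<epsilon>" using \<epsilon> by (simp add: divide_simps)
      then have "unsettled_prob (\<epsilon> / real (Suc m)) x = 0"
        using \<epsilon> unfolding \<epsilon>_def by (intro unsettled_prob_eq_0) (simp, linarith)
      then show ?thesis
        unfolding unsettled_prob_def by (subst (asm) prob_Collect_eq_0) auto
    qed
    then show "AE \<omega> in M. \<forall>m. settles (\<epsilon> / real (Suc m)) x \<omega>" for x :: "nat \<Rightarrow> real ^ 'd"
      by (subst AE_all_countable) blast
  qed
qed

end

lemma sets_equal_or_far:
  fixes f g :: "'a \<Rightarrow> 'b::euclidean_space"
  assumes [measurable]: "f \<in> borel_measurable N" "g \<in> borel_measurable N"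
  shows "{\<omega> \<in> space N. P \<longrightarrow> f \<omega> = g \<omega> \<or> c \<le> norm (f \<omega> - g \<omega>)} \<in> sets N"
  by measurable

theorem theorem1:
  fixes n :: nat
    and r \<mu> :: "nat \<Rightarrow> real"
    and x0 :: "nat \<Rightarrow> real ^ 'd"
  assumes "n \<ge> 3"
    and "\<And>i. i \<in> agents n \<Longrightarrow> r i > 0"
    and "\<And>i. i \<in> agents n \<Longrightarrow> 0 < \<mu> i \<and> \<mu> i < 1"
  shows "\<exists>xlim :: nat \<Rightarrow> (nat \<Rightarrow> nat set) \<Rightarrow> real ^ 'd.
     (\<forall>i\<in>agents n. xlim i \<in> borel_measurable (DW_measure n)) \<and>
     (\<forall>i\<in>agents n.
        measure (DW_measure n)
          {\<omega> \<in> space (DW_measure n). (\<lambda>t. DW_opinion r \<mu> x0 \<omega> t i) \<longlonglongrightarrow> xlim i \<omega>} = 1) \<and>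
     measure (DW_measure n)
       {\<omega> \<in> space (DW_measure n). \<forall>i\<in>agents n. \<forall>j\<in>agents n. i \<noteq> j \<longrightarrow>
          xlim i \<omega> = xlim j \<omega> \<or> norm (xlim i \<omega> - xlim j \<omega>) \<ge> max (r i) (r j)} = 1"
proof -
  have fin: "finite (agents n)" "agents n \<noteq> {}" using assms(1) by (auto simp: agents_def)
  define \<kappa> where "\<kappa> = Min ((\<lambda>i. min (\<mu> i) (1 - \<mu> i)) ` agents n)"
  have \<kappa>: "\<kappa> \<le> min (\<mu> i) (1 - \<mu> i)" if "i \<in> agents n" for i
    unfolding \<kappa>_def using that fin by (intro Min_le) auto
  have "0 < \<kappa>" unfolding \<kappa>_def using fin assms(3) by (subst Min_gr_iff) auto
  moreover have "0 < Min (r ` agents n)" using fin assms(2) by (subst Min_gr_iff) auto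
  ultimately interpret DW_model n r \<mu> \<kappa> "Min (r ` agents n)" "Max (r ` agents n)"
    using assms(1) \<kappa> fin by unfold_locales fastforce+
  interpret prob_space M by (rule prob_M)
  obtain \<delta> :: "nat \<Rightarrow> real" where \<delta>: "\<delta> \<longlonglongrightarrow> 0" and "AE \<omega> in M. \<forall>m. settles (\<delta> m) x0 \<omega>"
    using AE_settles by metis
  then have AE: "AE \<omega> in M. \<omega> \<in> space M \<and> (\<forall>m. settles (\<delta> m) x0 \<omega>)" by auto
  define xlim where "xlim i \<omega> = lim (\<lambda>t. traj x0 \<omega> t i)" for i \<omega>
  have xlim [measurable]: "xlim i \<in> borel_measurable M" for i
    unfolding xlim_def[abs_def] by measurable
  have conv: "(\<lambda>t. traj x0 \<omega> t i) \<longlonglongrightarrow> xlim i \<omega> \<longleftrightarrow> Cauchy (\<lambda>t. traj x0 \<omega> t i)" for i \<omega>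
    by (simp add: xlim_def Cauchy_convergent_iff convergent_LIMSEQ_iff)
  have "prob {\<omega> \<in> space M. (\<lambda>t. traj x0 \<omega> t i) \<longlonglongrightarrow> xlim i \<omega>} = 1" if "i \<in> agents n" for i
  proof (subst prob_Collect_eq_1)
    show "{\<omega> \<in> space M. (\<lambda>t. traj x0 \<omega> t i) \<longlonglongrightarrow> xlim i \<omega>} \<in> sets M"
      unfolding conv by measurable
    show "AE \<omega> in M. (\<lambda>t. traj x0 \<omega> t i) \<longlonglongrightarrow> xlim i \<omega>"
      using AE unfolding conv by eventually_elim (use Cauchy_of_settles[OF _ that _ \<delta>] in blast)
  qed
  moreover have "prob {\<omega> \<in> space M. \<forall>i\<in>agents n. \<forall>j\<in>agents n. i \<noteq> j \<longrightarrow>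
      xlim i \<omega> = xlim j \<omega> \<or> norm (xlim i \<omega> - xlim j \<omega>) \<ge> max (r i) (r j)} = 1"
  proof (subst prob_Collect_eq_1)
    have "{\<omega> \<in> space M. i \<noteq> j \<longrightarrow>
        xlim i \<omega> = xlim j \<omega> \<or> norm (xlim i \<omega> - xlim j \<omega>) \<ge> max (r i) (r j)} \<in> sets M" for i j
      by (rule sets_equal_or_far[OF xlim xlim])
    then show "{\<omega> \<in> space M. \<forall>i\<in>agents n. \<forall>j\<in>agents n. i \<noteq> j \<longrightarrow>
        xlim i \<omega> = xlim j \<omega> \<or> norm (xlim i \<omega> - xlim j \<omega>) \<ge> max (r i) (r j)} \<in> sets M"
      by (intro sets.sets_Collect_finite_All' fin)
    show "AE \<omega> in M. \<forall>i\<in>agents n. \<forall>j\<in>agents n. i \<noteq> j \<longrightarrow>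
        xlim i \<omega> = xlim j \<omega> \<or> norm (xlim i \<omega> - xlim j \<omega>) \<ge> max (r i) (r j)"
      using AE
    proof eventually_elim
      case (elim \<omega>)
      have lim: "(\<lambda>t. traj x0 \<omega> t i) \<longlonglongrightarrow> xlim i \<omega>" if "i \<in> agents n" for i
        unfolding conv using elim Cauchy_of_settles[OF _ that _ \<delta>] by blast
      show ?case
      proof (intro ballI impI)
        fix i j assume "i \<in> agents n" "j \<in> agents n"
        then show "xlim i \<omega> = xlim j \<omega> \<or> max (r i) (r j) \<le> norm (xlim i \<omega> - xlim j \<omega>)"
          using elim by (intro limits_equal_or_far[OF _ _ lim lim _ \<delta>]) auto
      qed
    qed
  qed
  ultimately show ?thesis using xlim by blast
qed

end
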